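(* Let $R$ be a (possibly non-commutative) $*$-ring. Then the category $\mathrm{Mod}_R$ of right $R$-modules admits a lax $\mathrm{O}(1)$-volutive structure.
   Context: A $*$-ring is a ring $R$ with a ring isomorphism $*\colon R\to R^{\mathrm{op}}$ satisfying $*^2=\mathrm{id}_R$. A lax $\mathrm{O}(1)$-volutive structure on a category $\mathcal{C}$ consists of a functor $d\colon\mathcal{C}\to\mathcal{C}^{\mathrm{op}}$ and a natural transformation $\eta\colon\mathrm{id}_{\mathcal{C}}\to d^{\mathrm{op}}\circ d$ satisfying $d(\eta_a)\circ\eta_{d(a)}=\mathrm{id}_{d(a)}$ for all $a\in\mathcal{C}$. *)

theory Defs
  imports "HOL-Algebra.Algebra"
begin

section \<open>Categories, functors, natural transformations\<close>

text \<open>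
  Hom-sets need not be disjoint, so identities, composition and the arrow part of a functor carry
  the objects they depend on: \<open>cmp C a b c g f\<close> is the composite of \<open>f : a \<rightarrow> b\<close> and
  \<open>g : b \<rightarrow> c\<close>.
\<close>

record ('o, 'a) category =
  obj  :: "'o set"
  arr  :: "'o \<Rightarrow> 'o \<Rightarrow> 'a set"
  ident :: "'o \<Rightarrow> 'a"
  cmp :: "'o \<Rightarrow> 'o \<Rightarrow> 'o \<Rightarrow> 'a \<Rightarrow> 'a \<Rightarrow> 'a"

definition is_category :: "('o, 'a) category \<Rightarrow> bool" where
  "is_category C \<longleftrightarrow>
     (\<forall>a\<in>obj C. ident C a \<in> arr C a a) \<and>
     (\<forall>a\<in>obj C. \<forall>b\<in>obj C. \<forall>c\<in>obj C. \<forall>f\<in>arr C a b. \<forall>g\<in>arr C b c.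
        cmp C a b c g f \<in> arr C a c) \<and>
     (\<forall>a\<in>obj C. \<forall>b\<in>obj C. \<forall>f\<in>arr C a b.
        cmp C a a b f (ident C a) = f \<and> cmp C a b b (ident C b) f = f) \<and>
     (\<forall>a\<in>obj C. \<forall>b\<in>obj C. \<forall>c\<in>obj C. \<forall>d\<in>obj C.
        \<forall>f\<in>arr C a b. \<forall>g\<in>arr C b c. \<forall>h\<in>arr C c d.
        cmp C a c d h (cmp C a b c g f) = cmp C a b d (cmp C b c d h g) f)"

definition op_cat :: "('o, 'a) category \<Rightarrow> ('o, 'a) category" where
  "op_cat C = \<lparr>obj = obj C, arr = (\<lambda>a b. arr C b a), ident = ident C,
               cmp = (\<lambda>a b c g f. cmp C c b a f g)\<rparr>"

record ('o, 'a, 'p, 'b) functor_data =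
  omap :: "'o \<Rightarrow> 'p"
  amap :: "'o \<Rightarrow> 'o \<Rightarrow> 'a \<Rightarrow> 'b"

definition is_functor ::
    "('o, 'a) category \<Rightarrow> ('p, 'b) category \<Rightarrow> ('o, 'a, 'p, 'b) functor_data \<Rightarrow> bool" where
  "is_functor C D F \<longleftrightarrow>
     is_category C \<and> is_category D \<and>
     (\<forall>a\<in>obj C. omap F a \<in> obj D) \<and>
     (\<forall>a\<in>obj C. \<forall>b\<in>obj C. \<forall>f\<in>arr C a b. amap F a b f \<in> arr D (omap F a) (omap F b)) \<and>
     (\<forall>a\<in>obj C. amap F a a (ident C a) = ident D (omap F a)) \<and>
     (\<forall>a\<in>obj C. \<forall>b\<in>obj C. \<forall>c\<in>obj C. \<forall>f\<in>arr C a b. \<forall>g\<in>arr C b c.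
        amap F a c (cmp C a b c g f) =
        cmp D (omap F a) (omap F b) (omap F c) (amap F b c g) (amap F a b f))"

definition id_functor :: "('o, 'a, 'o, 'a) functor_data" where
  "id_functor = \<lparr>omap = (\<lambda>a. a), amap = (\<lambda>a b f. f)\<rparr>"

definition comp_functor ::
    "('p, 'b, 'q, 'c) functor_data \<Rightarrow> ('o, 'a, 'p, 'b) functor_data
      \<Rightarrow> ('o, 'a, 'q, 'c) functor_data" where
  "comp_functor G F =
     \<lparr>omap = (\<lambda>a. omap G (omap F a)),
      amap = (\<lambda>a b f. amap G (omap F a) (omap F b) (amap F a b f))\<rparr>"

text \<open>For \<open>F : C \<rightarrow> D\<close>, the functor from \<^term>\<open>op_cat C\<close> to \<^term>\<open>op_cat D\<close>.\<close>

definition op_functor ::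
    "('o, 'a, 'p, 'b) functor_data \<Rightarrow> ('o, 'a, 'p, 'b) functor_data" where
  "op_functor F = \<lparr>omap = omap F, amap = (\<lambda>a b f. amap F b a f)\<rparr>"

definition is_nat_trans ::
    "('o, 'a) category \<Rightarrow> ('p, 'b) category \<Rightarrow> ('o, 'a, 'p, 'b) functor_data
      \<Rightarrow> ('o, 'a, 'p, 'b) functor_data \<Rightarrow> ('o \<Rightarrow> 'b) \<Rightarrow> bool" where
  "is_nat_trans C D F G \<eta> \<longleftrightarrow>
     is_functor C D F \<and> is_functor C D G \<and>
     (\<forall>a\<in>obj C. \<eta> a \<in> arr D (omap F a) (omap G a)) \<and>
     (\<forall>a\<in>obj C. \<forall>b\<in>obj C. \<forall>f\<in>arr C a b.
        cmp D (omap F a) (omap F b) (omap G b) (\<eta> b) (amap F a b f) =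
        cmp D (omap F a) (omap G a) (omap G b) (amap G a b f) (\<eta> a))"

text \<open>
  The codomain of \<open>d\<^sup>o\<^sup>p \<circ> d\<close> is \<^term>\<open>op_cat (op_cat C)\<close>, which equals \<^term>\<open>C\<close>.
  The arrow \<open>\<eta>\<^sub>a : a \<rightarrow> d (d a)\<close> is sent by \<open>d\<close> to an arrow \<open>d (d (d a)) \<rightarrow> d a\<close> of \<^term>\<open>C\<close>.
\<close>

definition lax_O1_volutive ::
    "('o, 'a) category \<Rightarrow> ('o, 'a, 'o, 'a) functor_data \<Rightarrow> ('o \<Rightarrow> 'a) \<Rightarrow> bool" where
  "lax_O1_volutive C d \<eta> \<longleftrightarrow>
     is_functor C (op_cat C) d \<and>
     is_nat_trans C C id_functor (comp_functor (op_functor d) d) \<eta> \<and>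
     (\<forall>a\<in>obj C.
        cmp C (omap d a) (omap d (omap d (omap d a))) (omap d a)
          (amap d a (omap d (omap d a)) (\<eta> a)) (\<eta> (omap d a))
        = ident C (omap d a))"


section \<open>Star-rings\<close>

definition op_ring :: "'r ring \<Rightarrow> 'r ring" where
  "op_ring R = R\<lparr>monoid.mult := (\<lambda>x y. y \<otimes>\<^bsub>R\<^esub> x)\<rparr>"

locale star_ring = ring R for R :: "'r ring" (structure) and star :: "'r \<Rightarrow> 'r" +
  assumes star_iso: "star \<in> ring_iso R (op_ring R)"
    and star_star: "x \<in> carrier R \<Longrightarrow> star (star x) = x"


section \<open>Right modules\<close>

text \<open>
  The record for modules of \<^theory>\<open>HOL-Algebra.Module\<close> is reused for right modules:
  \<open>r \<odot>\<^bsub>M\<^esub> m\<close> stands for \<open>m r\<close>, whence the order in \<open>act_assoc\<close>.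
  As there, the fields \<open>mult\<close> and \<open>one\<close> of a module play no role.
\<close>

locale right_module = R?: ring R + M?: abelian_group M
  for R :: "'r ring" (structure) and M :: "('r, 'm) module" (structure) +
  assumes act_closed:
      "\<lbrakk>r \<in> carrier R; x \<in> carrier M\<rbrakk> \<Longrightarrow> r \<odot>\<^bsub>M\<^esub> x \<in> carrier M"
    and act_add_ring:
      "\<lbrakk>r \<in> carrier R; s \<in> carrier R; x \<in> carrier M\<rbrakk> \<Longrightarrow>
       (r \<oplus>\<^bsub>R\<^esub> s) \<odot>\<^bsub>M\<^esub> x = r \<odot>\<^bsub>M\<^esub> x \<oplus>\<^bsub>M\<^esub> s \<odot>\<^bsub>M\<^esub> x"
    and act_add_module:
      "\<lbrakk>r \<in> carrier R; x \<in> carrier M; y \<in> carrier M\<rbrakk> \<Longrightarrow>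
       r \<odot>\<^bsub>M\<^esub> (x \<oplus>\<^bsub>M\<^esub> y) = r \<odot>\<^bsub>M\<^esub> x \<oplus>\<^bsub>M\<^esub> r \<odot>\<^bsub>M\<^esub> y"
    and act_assoc:
      "\<lbrakk>r \<in> carrier R; s \<in> carrier R; x \<in> carrier M\<rbrakk> \<Longrightarrow>
       (r \<otimes>\<^bsub>R\<^esub> s) \<odot>\<^bsub>M\<^esub> x = s \<odot>\<^bsub>M\<^esub> (r \<odot>\<^bsub>M\<^esub> x)"
    and act_one:
      "x \<in> carrier M \<Longrightarrow> \<one>\<^bsub>R\<^esub> \<odot>\<^bsub>M\<^esub> x = x"

text \<open>Maps are extensional on the carrier, so that equality of arrows is equality of functions.\<close>

definition rmod_hom ::
    "'r ring \<Rightarrow> ('r, 'm) module \<Rightarrow> ('r, 'n) module \<Rightarrow> ('m \<Rightarrow> 'n) set" where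
  "rmod_hom R M N =
     {f \<in> carrier M \<rightarrow>\<^sub>E carrier N.
        (\<forall>x\<in>carrier M. \<forall>y\<in>carrier M. f (x \<oplus>\<^bsub>M\<^esub> y) = f x \<oplus>\<^bsub>N\<^esub> f y) \<and>
        (\<forall>r\<in>carrier R. \<forall>x\<in>carrier M. f (r \<odot>\<^bsub>M\<^esub> x) = r \<odot>\<^bsub>N\<^esub> f x)}"

text \<open>
  A HOL type does not contain all modules, so \<open>Mod\<^sub>R\<close> is taken relative to a class \<open>\<V>\<close> of small
  subsets of an arbitrary type; for \<open>\<V> = UNIV\<close> it consists of all right modules carried by a
  subset of that type.
\<close>

definition size_class :: "'u set set \<Rightarrow> bool" where
  "size_class \<V> \<longleftrightarrow> (\<forall>A\<in>\<V>. Pow A \<subseteq> \<V>)"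

definition rmod_cat ::
    "'u set set \<Rightarrow> 'r ring \<Rightarrow> (('r, 'u) module, 'u \<Rightarrow> 'u) category" where
  "rmod_cat \<V> R =
     \<lparr>obj = {M. right_module R M \<and> carrier M \<in> \<V>},
      arr = rmod_hom R,
      ident = (\<lambda>M. \<lambda>x\<in>carrier M. x),
      cmp = (\<lambda>L M N g f. compose (carrier L) g f)\<rparr>"


section \<open>The duality given by maps into the ring\<close>

definition regular_rmod :: "'r ring \<Rightarrow> ('r, 'r) module" where
  "regular_rmod R =
     \<lparr>carrier = carrier R, monoid.mult = monoid.mult R, one = \<one>\<^bsub>R\<^esub>, ring.zero = \<zero>\<^bsub>R\<^esub>, add = add R,
      smult = (\<lambda>r x. x \<otimes>\<^bsub>R\<^esub> r)\<rparr>"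

text \<open>
  The left module \<open>Hom\<^sub>R(M, R)\<close> becomes a right module through \<open>(\<phi> r)(m) = r\<^sup>* \<phi>(m)\<close>.
\<close>

definition dual_rmod ::
    "'r ring \<Rightarrow> ('r \<Rightarrow> 'r) \<Rightarrow> ('r, 'm) module \<Rightarrow> ('r, 'm \<Rightarrow> 'r) module" where
  "dual_rmod R star M =
     \<lparr>carrier = rmod_hom R M (regular_rmod R),
      monoid.mult = undefined, one = undefined,
      ring.zero = (\<lambda>m\<in>carrier M. \<zero>\<^bsub>R\<^esub>),
      add = (\<lambda>\<phi> \<psi>. \<lambda>m\<in>carrier M. \<phi> m \<oplus>\<^bsub>R\<^esub> \<psi> m),
      smult = (\<lambda>r \<phi>. \<lambda>m\<in>carrier M. star r \<otimes>\<^bsub>R\<^esub> \<phi> m)\<rparr>"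

text \<open>
  Duals of modules in \<^term>\<open>rmod_cat \<V> R\<close> are again small, up to bijection. This holds when
  \<open>\<V>\<close> consists of the small sets of a universe containing \<open>R\<close>.
\<close>

definition dual_closed :: "'u set set \<Rightarrow> 'r ring \<Rightarrow> bool" where
  "dual_closed \<V> R \<longleftrightarrow>
     (\<forall>M\<in>obj (rmod_cat \<V> R).
        \<exists>g. inj_on g (rmod_hom R M (regular_rmod R)) \<and>
            g ` rmod_hom R M (regular_rmod R) \<in> \<V>)"

text \<open>
  The functor \<open>d\<close> is \<open>Hom\<^sub>R(-, R)\<close> and \<open>\<eta>\<close> is evaluation, \<open>\<eta>\<^sub>M(m)(\<phi>) = \<phi>(m)\<^sup>*\<close>, up to the
  isomorphisms \<open>dec M : d M \<rightarrow> Hom\<^sub>R(M, R)\<close>. These are needed since \<^term>\<open>dual_rmod R star M\<close>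
  lives on a different type than \<^term>\<open>M\<close>.
\<close>

definition is_hom_duality ::
    "'u set set \<Rightarrow> 'r ring \<Rightarrow> ('r \<Rightarrow> 'r)
      \<Rightarrow> (('r, 'u) module, 'u \<Rightarrow> 'u, ('r, 'u) module, 'u \<Rightarrow> 'u) functor_data
      \<Rightarrow> (('r, 'u) module \<Rightarrow> 'u \<Rightarrow> 'u) \<Rightarrow> bool" where
  "is_hom_duality \<V> R star d \<eta> \<longleftrightarrow>
     (\<exists>dec :: ('r, 'u) module \<Rightarrow> 'u \<Rightarrow> 'u \<Rightarrow> 'r.
        (\<forall>M\<in>obj (rmod_cat \<V> R).
           dec M \<in> rmod_hom R (omap d M) (dual_rmod R star M) \<and>
           bij_betw (dec M) (carrier (omap d M)) (carrier (dual_rmod R star M))) \<and>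
        (\<forall>M\<in>obj (rmod_cat \<V> R). \<forall>N\<in>obj (rmod_cat \<V> R). \<forall>f\<in>rmod_hom R M N.
           \<forall>p\<in>carrier (omap d N).
             dec M (amap d M N f p) = compose (carrier M) (dec N p) f) \<and>
        (\<forall>M\<in>obj (rmod_cat \<V> R). \<forall>m\<in>carrier M. \<forall>p\<in>carrier (omap d M).
             dec (omap d M) (\<eta> M m) p = star (dec M p m)))"

end

theory Submission
  imports Defs
begin

text \<open>
  If some dual is not small, the constant functor at a zero module is a lax volutive structure.
  Otherwise transport \<open>Hom\<^sub>R(M, R)\<close> along an injection into the
  underlying type to get \<open>d M\<close>, with \<open>dec M : d M \<cong> Hom\<^sub>R(M, R)\<close>. Since every \<open>dec M\<close> is injective,
  all identities may be checked after applying it, where they are statements about evaluation; the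
  triangle identity becomes \<open>(\<phi>(m)\<^sup>*)\<^sup>* = \<phi>(m)\<close>.
\<close>

section \<open>Linear maps\<close>

lemma rmod_homI:
  assumes "\<And>x. x \<in> carrier M \<Longrightarrow> f x \<in> carrier N"
    and "f \<in> extensional (carrier M)"
    and "\<And>x y. x \<in> carrier M \<Longrightarrow> y \<in> carrier M \<Longrightarrow> f (x \<oplus>\<^bsub>M\<^esub> y) = f x \<oplus>\<^bsub>N\<^esub> f y"
    and "\<And>r x. r \<in> carrier R \<Longrightarrow> x \<in> carrier M \<Longrightarrow> f (r \<odot>\<^bsub>M\<^esub> x) = r \<odot>\<^bsub>N\<^esub> f x"
  shows "f \<in> rmod_hom R M N"
  using assms by (auto simp: rmod_hom_def PiE_def)

lemma
  assumes "f \<in> rmod_hom R M N"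
  shows rmod_hom_closed: "x \<in> carrier M \<Longrightarrow> f x \<in> carrier N"
    and rmod_hom_ext: "f \<in> extensional (carrier M)"
    and rmod_hom_add: "x \<in> carrier M \<Longrightarrow> y \<in> carrier M \<Longrightarrow> f (x \<oplus>\<^bsub>M\<^esub> y) = f x \<oplus>\<^bsub>N\<^esub> f y"
    and rmod_hom_act: "r \<in> carrier R \<Longrightarrow> x \<in> carrier M \<Longrightarrow> f (r \<odot>\<^bsub>M\<^esub> x) = r \<odot>\<^bsub>N\<^esub> f x"
  using assms by (auto simp: rmod_hom_def PiE_def)

lemma rmod_hom_eqI:
  assumes "f \<in> rmod_hom R M N" "g \<in> rmod_hom R M N'"
    and "\<And>x. x \<in> carrier M \<Longrightarrow> f x = g x"
  shows "f = g"
  using assms by (intro extensionalityI[of f "carrier M" g]) (auto dest: rmod_hom_ext)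

lemma
  assumes "right_module R M"
  shows rmod_add_closed: "x \<in> carrier M \<Longrightarrow> y \<in> carrier M \<Longrightarrow> x \<oplus>\<^bsub>M\<^esub> y \<in> carrier M"
    and rmod_act_closed: "r \<in> carrier R \<Longrightarrow> x \<in> carrier M \<Longrightarrow> r \<odot>\<^bsub>M\<^esub> x \<in> carrier M"
proof -
  interpret M: right_module R M by fact
  show "x \<in> carrier M \<Longrightarrow> y \<in> carrier M \<Longrightarrow> x \<oplus>\<^bsub>M\<^esub> y \<in> carrier M"
    by (rule M.M.a_closed)
  show "r \<in> carrier R \<Longrightarrow> x \<in> carrier M \<Longrightarrow> r \<odot>\<^bsub>M\<^esub> x \<in> carrier M"
    by (rule M.act_closed)
qed

lemma rmod_hom_compose:
  assumes "right_module R L" "f \<in> rmod_hom R L M" "g \<in> rmod_hom R M N"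
  shows "compose (carrier L) g f \<in> rmod_hom R L N"
  using assms
  by (intro rmod_homI)
    (auto simp: compose_def rmod_add_closed rmod_act_closed rmod_hom_add rmod_hom_act
      rmod_hom_closed[OF assms(2)] rmod_hom_closed[OF assms(3)])

lemma rmod_hom_id:
  assumes "right_module R M"
  shows "(\<lambda>x\<in>carrier M. x) \<in> rmod_hom R M M"
  using assms by (intro rmod_homI) (auto simp: rmod_add_closed rmod_act_closed)

lemma rmod_hom_inv:
  assumes "right_module R M" "f \<in> rmod_hom R M N" "bij_betw f (carrier M) (carrier N)"
    and "right_module R N"
  shows "(\<lambda>y\<in>carrier N. inv_into (carrier M) f y) \<in> rmod_hom R N M"
proof (intro rmod_homI)
  have inj: "inj_on f (carrier M)" and im: "f ` carrier M = carrier N"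
    using assms(3) by (auto simp: bij_betw_def)
  let ?g = "inv_into (carrier M) f"
  have g: "?g y \<in> carrier M" "f (?g y) = y" if "y \<in> carrier N" for y
    using that im by (auto intro: inv_into_into f_inv_into_f)
  show "(\<lambda>y\<in>carrier N. ?g y) y \<in> carrier M" if "y \<in> carrier N" for y
    using that g by simp
  show "(\<lambda>y\<in>carrier N. ?g y) (x \<oplus>\<^bsub>N\<^esub> y) = (\<lambda>y\<in>carrier N. ?g y) x \<oplus>\<^bsub>M\<^esub> (\<lambda>y\<in>carrier N. ?g y) y"
    if "x \<in> carrier N" "y \<in> carrier N" for x y
  proof -
    have "?g (x \<oplus>\<^bsub>N\<^esub> y) = ?g (f (?g x \<oplus>\<^bsub>M\<^esub> ?g y))"
      using that g assms by (simp add: rmod_hom_add)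
    also have "\<dots> = ?g x \<oplus>\<^bsub>M\<^esub> ?g y"
      using that g assms inj by (simp add: rmod_add_closed)
    finally show ?thesis
      using that assms by (simp add: rmod_add_closed)
  qed
  show "(\<lambda>y\<in>carrier N. ?g y) (r \<odot>\<^bsub>N\<^esub> y) = r \<odot>\<^bsub>M\<^esub> (\<lambda>y\<in>carrier N. ?g y) y"
    if "r \<in> carrier R" "y \<in> carrier N" for r y
  proof -
    have "?g (r \<odot>\<^bsub>N\<^esub> y) = ?g (f (r \<odot>\<^bsub>M\<^esub> ?g y))"
      using that g assms by (simp add: rmod_hom_act)
    also have "\<dots> = r \<odot>\<^bsub>M\<^esub> ?g y"
      using that g assms inj by (simp add: rmod_act_closed)
    finally show ?thesis
      using that assms by (simp add: rmod_act_closed)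
  qed
qed simp

section \<open>The category of right modules\<close>

lemma rmod_cat_simps [simp]:
  "M \<in> obj (rmod_cat \<V> R) \<longleftrightarrow> right_module R M \<and> carrier M \<in> \<V>"
  "arr (rmod_cat \<V> R) = rmod_hom R"
  "ident (rmod_cat \<V> R) M = (\<lambda>x\<in>carrier M. x)"
  "cmp (rmod_cat \<V> R) L M N g f = compose (carrier L) g f"
  by (simp_all add: rmod_cat_def)

lemma op_cat_simps [simp]:
  "obj (op_cat C) = obj C"
  "arr (op_cat C) a b = arr C b a"
  "ident (op_cat C) = ident C"
  "cmp (op_cat C) a b c g f = cmp C c b a f g"
  by (simp_all add: op_cat_def)

lemma functor_simps [simp]:
  "omap id_functor a = a"
  "amap id_functor a b f = f"
  "omap (comp_functor G F) a = omap G (omap F a)"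
  "amap (comp_functor G F) a b f = amap G (omap F a) (omap F b) (amap F a b f)"
  "omap (op_functor F') a' = omap F' a'"
  "amap (op_functor F') a' b' f' = amap F' b' a' f'"
  by (simp_all add: id_functor_def comp_functor_def op_functor_def)

lemma is_category_rmod_cat: "is_category (rmod_cat \<V> R)"
  unfolding is_category_def
proof (intro conjI ballI)
  fix M assume "M \<in> obj (rmod_cat \<V> R)"
  then show "ident (rmod_cat \<V> R) M \<in> arr (rmod_cat \<V> R) M M"
    by (simp add: rmod_hom_id)
next
  fix M N f
  assume "M \<in> obj (rmod_cat \<V> R)" "N \<in> obj (rmod_cat \<V> R)" "f \<in> arr (rmod_cat \<V> R) M N"
  then have "f \<in> rmod_hom R M N" by simp
  \<comment> \<open>On the carrier of M the identity changes nothing; off it \<open>compose\<close>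
    returns \<open>undefined\<close>, which is also the value of the extensional map
    \<open>f\<close>.\<close>
  then show "cmp (rmod_cat \<V> R) M M N f (ident (rmod_cat \<V> R) M) = f"
    "cmp (rmod_cat \<V> R) M N N (ident (rmod_cat \<V> R) N) f = f"
    by (auto simp: fun_eq_iff compose_def rmod_hom_closed
        dest: rmod_hom_ext intro: extensional_arb[symmetric])
next
  fix K L M N f g h
  assume "K \<in> obj (rmod_cat \<V> R)" "L \<in> obj (rmod_cat \<V> R)" "M \<in> obj (rmod_cat \<V> R)"
    "N \<in> obj (rmod_cat \<V> R)" "f \<in> arr (rmod_cat \<V> R) K L"
    "g \<in> arr (rmod_cat \<V> R) L M" "h \<in> arr (rmod_cat \<V> R) M N"
  then show "cmp (rmod_cat \<V> R) K M N h (cmp (rmod_cat \<V> R) K L M g f) =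
      cmp (rmod_cat \<V> R) K L N (cmp (rmod_cat \<V> R) L M N h g) f"
    by (auto simp: fun_eq_iff compose_def rmod_hom_closed)
qed (auto intro: rmod_hom_compose)

lemma is_category_op_cat: "is_category C \<Longrightarrow> is_category (op_cat C)"
  unfolding is_category_def by auto

lemma is_functor_id: "is_category C \<Longrightarrow> is_functor C C id_functor"
  unfolding is_functor_def by (auto simp: is_category_def)

text \<open>Each of the two applications of \<open>d\<close> reverses arrows and the order of
  composition, so the composite preserves both; its laws are those of \<open>d\<close> used
  twice.\<close>

lemma is_functor_double_dual:
  assumes "is_functor C (op_cat C) d"
  shows "is_functor C C (comp_functor (op_functor d) d)"
  using assms unfolding is_functor_def by auto

text \<open>Functoriality of the identity and of the double dual follows from that of
  \<open>d\<close>. What remains is functoriality of \<open>d\<close>, typing and naturality of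
  \<open>\<eta>\<close>, and the triangle identity.\<close>

lemma lax_O1_volutiveI:
  assumes "is_functor C (op_cat C) d"
    and "\<And>a. a \<in> obj C \<Longrightarrow> \<eta> a \<in> arr C a (omap d (omap d a))"
    and "\<And>a b f. a \<in> obj C \<Longrightarrow> b \<in> obj C \<Longrightarrow> f \<in> arr C a b \<Longrightarrow>
      cmp C a b (omap d (omap d b)) (\<eta> b) f =
      cmp C a (omap d (omap d a)) (omap d (omap d b))
        (amap d (omap d b) (omap d a) (amap d a b f)) (\<eta> a)"
    and "\<And>a. a \<in> obj C \<Longrightarrow>
      cmp C (omap d a) (omap d (omap d (omap d a))) (omap d a)
        (amap d a (omap d (omap d a)) (\<eta> a)) (\<eta> (omap d a)) = ident C (omap d a)"
  shows "lax_O1_volutive C d \<eta>"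
  using assms is_functor_double_dual[OF assms(1)] is_functor_id[of C]
  unfolding lax_O1_volutive_def is_nat_trans_def by (auto simp: is_functor_def)

section \<open>The constant structure\<close>

text \<open>The point is a parameter because it must be chosen so that its singleton lies in
  \<open>\<V>\<close>.\<close>

definition zero_rmod :: "'u \<Rightarrow> ('r, 'u) module" where
  "zero_rmod z = \<lparr>carrier = {z}, monoid.mult = (\<lambda>_ _. z), one = z, ring.zero = z,
     add = (\<lambda>_ _. z), smult = (\<lambda>_ _. z)\<rparr>"

lemma right_module_zero_rmod:
  assumes "ring R"
  shows "right_module R (zero_rmod z)"
  using assms
  by (intro right_module.intro abelian_groupI right_module_axioms.intro)
    (auto simp: zero_rmod_def)

text \<open>A constant functor with identities as values is contravariant as well as covariant, and
  naturality and the triangle are equations between maps into a zero module, where all parallel maps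
  agree.\<close>

lemma ex_lax_O1_volutive_rmod_cat:
  fixes R :: "'r ring" and \<V> :: "'u set set"
  assumes "ring R" "size_class \<V>"
  shows "\<exists>d \<eta>. lax_O1_volutive (rmod_cat \<V> R) d \<eta>"
proof -
  \<comment> \<open>The choice is meaningful as soon as the category has an object, as
    \<open>car\<close> shows; without objects all conditions are vacuous.\<close>
  define z :: 'u where "z = (SOME z. {z} \<in> \<V>)"
  let ?Z = "zero_rmod z :: ('r, 'u) module"
  define d :: "(('r, 'u) module, 'u \<Rightarrow> 'u, ('r, 'u) module, 'u \<Rightarrow> 'u) functor_data"
    where "d = \<lparr>omap = (\<lambda>_. ?Z), amap = (\<lambda>_ _ _. \<lambda>x\<in>carrier ?Z. x)\<rparr>"
  define \<eta> :: "('r, 'u) module \<Rightarrow> 'u \<Rightarrow> 'u" where "\<eta> = (\<lambda>M. \<lambda>x\<in>carrier M. z)"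
  have d [simp]: "omap d M = ?Z" "amap d M N f = (\<lambda>x\<in>carrier ?Z. x)" for M N f
    by (simp_all add: d_def)
  have Z: "right_module R ?Z" by (rule right_module_zero_rmod[OF assms(1)])
  \<comment> \<open>The singleton of the zero of any object M is a subset of its carrier, so it lies
    in \<open>\<V>\<close> by closure under subsets, and some \<open>z\<close> as chosen
    exists.\<close>
  have car: "carrier ?Z \<in> \<V>" if M: "right_module R M" "carrier M \<in> \<V>" for M :: "('r, 'u) module"
  proof -
    interpret M: right_module R M by fact
    have "Pow (carrier M) \<subseteq> \<V>"
      using assms(2) M(2) unfolding size_class_def by (rule bspec)
    then have "{\<zero>\<^bsub>M\<^esub>} \<in> \<V>"
      by (rule subsetD) simp
    then have "{z} \<in> \<V>" unfolding z_def by (rule someI)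
    then show ?thesis by (simp add: zero_rmod_def)
  qed
  have eta: "\<eta> M \<in> rmod_hom R M ?Z" if "right_module R M" for M :: "('r, 'u) module"
    using that
    by (intro rmod_homI) (auto simp: \<eta>_def zero_rmod_def rmod_add_closed rmod_act_closed)
  have zero_unique: "f = g" if "f \<in> rmod_hom R M ?Z" "g \<in> rmod_hom R M ?Z"
    for f g and M :: "('r, 'u) module"
  proof (rule rmod_hom_eqI[OF that])
    fix x assume "x \<in> carrier M"
    then show "f x = g x"
      using rmod_hom_closed[OF that(1)] rmod_hom_closed[OF that(2)]
      by (simp add: zero_rmod_def)
  qed
  have "is_functor (rmod_cat \<V> R) (op_cat (rmod_cat \<V> R)) d"
    unfolding is_functor_def
  proof (intro conjI ballI is_category_op_cat is_category_rmod_cat)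
    fix K L M :: "('r, 'u) module" and f g
    show "amap d K M (cmp (rmod_cat \<V> R) K L M g f) =
        cmp (op_cat (rmod_cat \<V> R)) (omap d K) (omap d L) (omap d M) (amap d L M g) (amap d K L f)"
      by (simp add: fun_eq_iff compose_def)
  qed (auto intro: car simp: Z rmod_hom_id)
  then have "lax_O1_volutive (rmod_cat \<V> R) d \<eta>"
  proof (rule lax_O1_volutiveI)
    fix M N f
    assume "M \<in> obj (rmod_cat \<V> R)" "N \<in> obj (rmod_cat \<V> R)" "f \<in> arr (rmod_cat \<V> R) M N"
    then show "cmp (rmod_cat \<V> R) M N (omap d (omap d N)) (\<eta> N) f =
      cmp (rmod_cat \<V> R) M (omap d (omap d M)) (omap d (omap d N))
        (amap d (omap d N) (omap d M) (amap d M N f)) (\<eta> M)"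
      by (simp, intro zero_unique[where M = M] rmod_hom_compose[of R M f N]
          rmod_hom_compose[of R M "\<eta> M" ?Z] eta rmod_hom_id Z) auto
  next
    fix M assume "M \<in> obj (rmod_cat \<V> R)"
    show "cmp (rmod_cat \<V> R) (omap d M) (omap d (omap d (omap d M))) (omap d M)
        (amap d M (omap d (omap d M)) (\<eta> M)) (\<eta> (omap d M)) =
      ident (rmod_cat \<V> R) (omap d M)"
      by (simp, intro zero_unique[where M = ?Z] rmod_hom_compose[of R ?Z "\<eta> ?Z" ?Z]
          eta rmod_hom_id Z)
  qed (simp add: eta)
  then show ?thesis by blast
qed

section \<open>Duals\<close>

context star_ring
begin

lemma star_closed: "x \<in> carrier R \<Longrightarrow> star x \<in> carrier R"
  and star_mult: "x \<in> carrier R \<Longrightarrow> y \<in> carrier R \<Longrightarrow> star (x \<otimes> y) = star y \<otimes> star x"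
  and star_add: "x \<in> carrier R \<Longrightarrow> y \<in> carrier R \<Longrightarrow> star (x \<oplus> y) = star x \<oplus> star y"
  and star_one: "star \<one> = \<one>"
  using star_iso by (auto simp: ring_iso_def ring_hom_def op_ring_def)

lemma regular_rmod_simps [simp]:
  "carrier (regular_rmod R) = carrier R"
  "x \<oplus>\<^bsub>regular_rmod R\<^esub> y = x \<oplus> y"
  "r \<odot>\<^bsub>regular_rmod R\<^esub> x = x \<otimes> r"
  by (simp_all add: regular_rmod_def)

lemma dual_rmod_simps [simp]:
  "carrier (dual_rmod R star M) = rmod_hom R M (regular_rmod R)"
  "\<zero>\<^bsub>dual_rmod R star M\<^esub> = (\<lambda>m\<in>carrier M. \<zero>)"
  "\<phi> \<oplus>\<^bsub>dual_rmod R star M\<^esub> \<psi> = (\<lambda>m\<in>carrier M. \<phi> m \<oplus> \<psi> m)"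
  "r \<odot>\<^bsub>dual_rmod R star M\<^esub> \<phi> = (\<lambda>m\<in>carrier M. star r \<otimes> \<phi> m)"
  by (simp_all add: dual_rmod_def)

lemma functional_closed:
  "\<phi> \<in> rmod_hom R M (regular_rmod R) \<Longrightarrow> x \<in> carrier M \<Longrightarrow> \<phi> x \<in> carrier R"
  using rmod_hom_closed by fastforce

lemma functional_add:
  assumes "right_module R M"
    "\<phi> \<in> rmod_hom R M (regular_rmod R)" "\<psi> \<in> rmod_hom R M (regular_rmod R)"
  shows "(\<lambda>m\<in>carrier M. \<phi> m \<oplus> \<psi> m) \<in> rmod_hom R M (regular_rmod R)"
  using assms
  by (intro rmod_homI)
    (auto simp: functional_closed rmod_add_closed rmod_act_closed rmod_hom_add rmod_hom_act
      l_distr a_ac)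

text \<open>Left multiplication commutes with the right action on R by associativity, so it
  preserves linearity even when R is not commutative.\<close>

lemma functional_mult:
  assumes "right_module R M" "\<phi> \<in> rmod_hom R M (regular_rmod R)" "s \<in> carrier R"
  shows "(\<lambda>m\<in>carrier M. s \<otimes> \<phi> m) \<in> rmod_hom R M (regular_rmod R)"
  using assms
  by (intro rmod_homI)
    (auto simp: functional_closed rmod_add_closed rmod_act_closed rmod_hom_add rmod_hom_act
      r_distr m_assoc)

lemma functional_zero:
  assumes "right_module R M"
  shows "(\<lambda>m\<in>carrier M. \<zero>) \<in> rmod_hom R M (regular_rmod R)"
  using assms by (intro rmod_homI) (auto simp: rmod_add_closed rmod_act_closed)

text \<open>Functionals form a left module under left multiplication. As \<open>star\<close>
  reverses products, acting through \<open>star r\<close> turns it into a right module: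
  \<open>star (r \<otimes> s) = star s \<otimes> star r\<close> is what \<open>act_assoc\<close>
  asks for.\<close>

lemma right_module_dual_rmod:
  assumes M: "right_module R M"
  shows "right_module R (dual_rmod R star M)"
proof (intro right_module.intro right_module_axioms.intro abelian_groupI)
  show "ring R" by (rule ring_axioms)
next
  fix \<phi> assume phi: "\<phi> \<in> carrier (dual_rmod R star M)"
  \<comment> \<open>The negative is taken as a left multiple by minus one, so that its linearity is
    an instance of \<open>functional_mult\<close>.\<close>
  then have "(\<lambda>m\<in>carrier M. \<ominus> \<one> \<otimes> \<phi> m) \<in> rmod_hom R M (regular_rmod R)"
    by (auto intro: functional_mult[OF M])
  moreover have "(\<lambda>m\<in>carrier M. \<ominus> \<one> \<otimes> \<phi> m) \<oplus>\<^bsub>dual_rmod R star M\<^esub> \<phi> = \<zero>\<^bsub>dual_rmod R star M\<^esub>"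
    using phi by (auto simp: functional_closed l_minus l_neg intro!: restrict_ext)
  ultimately show "\<exists>\<psi>\<in>carrier (dual_rmod R star M).
      \<psi> \<oplus>\<^bsub>dual_rmod R star M\<^esub> \<phi> = \<zero>\<^bsub>dual_rmod R star M\<^esub>"
    by (metis dual_rmod_simps(1))
next
  fix \<phi> assume "\<phi> \<in> carrier (dual_rmod R star M)"
  then have phi: "\<phi> \<in> rmod_hom R M (regular_rmod R)" by simp
  \<comment> \<open>The operations of the dual return restricted functions; extensionality of
    \<open>\<phi>\<close> identifies its restriction with \<open>\<phi>\<close> itself in the two
    neutral laws.\<close>
  have phi_ext: "(\<lambda>m\<in>carrier M. \<phi> m) = \<phi>"
    using rmod_hom_ext[OF phi] by (rule extensional_restrict)
  have "(\<lambda>m\<in>carrier M. \<zero> \<oplus> \<phi> m) = (\<lambda>m\<in>carrier M. \<phi> m)"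
    using phi by (intro restrict_ext) (simp add: functional_closed)
  then show "\<zero>\<^bsub>dual_rmod R star M\<^esub> \<oplus>\<^bsub>dual_rmod R star M\<^esub> \<phi> = \<phi>"
    using phi_ext by (auto cong: restrict_cong)
  have "(\<lambda>m\<in>carrier M. \<one> \<otimes> \<phi> m) = (\<lambda>m\<in>carrier M. \<phi> m)"
    using phi by (intro restrict_ext) (simp add: functional_closed)
  then show "\<one> \<odot>\<^bsub>dual_rmod R star M\<^esub> \<phi> = \<phi>"
    using phi_ext by (simp add: star_one)
qed (auto simp: functional_add functional_mult functional_zero star_closed M functional_closed
      star_add star_mult l_distr r_distr m_assoc a_ac intro!: restrict_ext)

end

section \<open>Transport of a module structure along an injection\<close>

definition transport_rmod :: "('m \<Rightarrow> 'n) \<Rightarrow> ('r, 'm) module \<Rightarrow> ('r, 'n) module" where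
  "transport_rmod g M =
     (let h = inv_into (carrier M) g in
      \<lparr>carrier = g ` carrier M, monoid.mult = undefined, one = undefined, ring.zero = g \<zero>\<^bsub>M\<^esub>,
       add = (\<lambda>x y. g (h x \<oplus>\<^bsub>M\<^esub> h y)), smult = (\<lambda>r x. g (r \<odot>\<^bsub>M\<^esub> h x))\<rparr>)"

text \<open>On the image of \<open>g\<close> the map \<open>h\<close> undoes \<open>g\<close>, so
  each law reduces to the same law of M. This moves the dual from a type of functions to the type
  that carries the objects of the category.\<close>

lemma right_module_transport_rmod:
  assumes M: "right_module R M" and g: "inj_on g (carrier M)"
  shows "right_module R (transport_rmod g M)"
proof -
  interpret M: right_module R M by fact
  show ?thesis
  proof (intro right_module.intro right_module_axioms.intro abelian_groupI M.R.ring_axioms)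
    fix x assume "x \<in> carrier (transport_rmod g M)"
    then obtain m where m: "m \<in> carrier M" "x = g m"
      by (auto simp: transport_rmod_def Let_def)
    show "\<exists>y\<in>carrier (transport_rmod g M). y \<oplus>\<^bsub>transport_rmod g M\<^esub> x = \<zero>\<^bsub>transport_rmod g M\<^esub>"
      using m g
      by (intro bexI[of _ "g (\<ominus>\<^bsub>M\<^esub> m)"]) (auto simp: transport_rmod_def Let_def M.M.l_neg)
  qed (use g in \<open>auto simp: transport_rmod_def Let_def M.act_closed M.act_add_ring
        M.act_add_module M.act_assoc M.act_one M.M.a_ac\<close>)
qed

lemma
  assumes M: "right_module R M" and g: "inj_on g (carrier M)"
  shows transport_rmod_hom:
      "(\<lambda>x\<in>carrier (transport_rmod g M). inv_into (carrier M) g x)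
        \<in> rmod_hom R (transport_rmod g M) M" (is "?h \<in> _")
    and transport_rmod_bij:
      "bij_betw (\<lambda>x\<in>carrier (transport_rmod g M). inv_into (carrier M) g x)
        (carrier (transport_rmod g M)) (carrier M)"
proof -
  interpret M: right_module R M by fact
  show "?h \<in> rmod_hom R (transport_rmod g M) M"
    by (intro rmod_homI)
      (auto simp: transport_rmod_def Let_def M.act_closed inj_on_eq_iff[OF g] inv_into_f_f[OF g])
  have "bij_betw (inv_into (carrier M) g) (g ` carrier M) (carrier M)"
    using g by (simp add: bij_betw_inv_into inj_on_imp_bij_betw)
  then show "bij_betw ?h (carrier (transport_rmod g M)) (carrier M)"
    by (subst bij_betw_cong[where g = "inv_into (carrier M) g"])
      (simp_all add: transport_rmod_def Let_def)
qed

section \<open>The duality\<close>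

text \<open>Separates the duality from the way duals are encoded: from an objectwise choice of small
  copies \<open>D M\<close> of the duals, the action on maps and the evaluation are built inside the
  locale.\<close>

locale coded_duality = star_ring R star for R :: "'r ring" (structure) and star +
  fixes \<V> :: "'u set set"
    and D :: "('r, 'u) module \<Rightarrow> ('r, 'u) module"
    and dec :: "('r, 'u) module \<Rightarrow> 'u \<Rightarrow> 'u \<Rightarrow> 'r"
  assumes D_module: "M \<in> obj (rmod_cat \<V> R) \<Longrightarrow> right_module R (D M)"
    and D_small: "M \<in> obj (rmod_cat \<V> R) \<Longrightarrow> carrier (D M) \<in> \<V>"
    and dec_hom: "M \<in> obj (rmod_cat \<V> R) \<Longrightarrow> dec M \<in> rmod_hom R (D M) (dual_rmod R star M)"
    and dec_bij: "M \<in> obj (rmod_cat \<V> R) \<Longrightarrow>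
      bij_betw (dec M) (carrier (D M)) (carrier (dual_rmod R star M))"
begin

abbreviation "Ob \<equiv> obj (rmod_cat \<V> R)"

definition enc :: "('r, 'u) module \<Rightarrow> ('u \<Rightarrow> 'r) \<Rightarrow> 'u" where
  "enc M = (\<lambda>\<phi>\<in>carrier (dual_rmod R star M). inv_into (carrier (D M)) (dec M) \<phi>)"

definition pullback :: "('r, 'u) module \<Rightarrow> ('r, 'u) module \<Rightarrow> ('u \<Rightarrow> 'u) \<Rightarrow> 'u \<Rightarrow> 'u" where
  "pullback M N f = (\<lambda>p\<in>carrier (D N). enc M (compose (carrier M) (dec N p) f))"

definition evaluation :: "('r, 'u) module \<Rightarrow> 'u \<Rightarrow> 'u" where
  "evaluation M = (\<lambda>m\<in>carrier M. enc (D M) (\<lambda>p\<in>carrier (D M). star (dec M p m)))"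

definition dual_functor ::
    "(('r, 'u) module, 'u \<Rightarrow> 'u, ('r, 'u) module, 'u \<Rightarrow> 'u) functor_data" where
  "dual_functor = \<lparr>omap = D, amap = pullback\<rparr>"

lemma dual_functor_simps [simp]:
  "omap dual_functor = D"
  "amap dual_functor = pullback"
  by (simp_all add: dual_functor_def)

lemma Ob_module: "M \<in> Ob \<Longrightarrow> right_module R M"
  by simp

lemma D_Ob: "M \<in> Ob \<Longrightarrow> D M \<in> Ob"
  using D_module D_small by simp

text \<open>Membership in \<open>Ob\<close> now stays folded, so that it matches the premises of the
  facts about \<open>D\<close> and \<open>dec\<close>.\<close>

declare rmod_cat_simps(1) [simp del]

lemma enc_hom: "M \<in> Ob \<Longrightarrow> enc M \<in> rmod_hom R (dual_rmod R star M) (D M)"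
  unfolding enc_def
  by (rule rmod_hom_inv[OF D_module dec_hom dec_bij right_module_dual_rmod[OF Ob_module]])

lemma dec_enc:
  assumes "M \<in> Ob" "\<phi> \<in> rmod_hom R M (regular_rmod R)"
  shows "dec M (enc M \<phi>) = \<phi>"
proof -
  have "\<phi> \<in> carrier (dual_rmod R star M)" using assms by simp
  then show ?thesis
    using bij_betw_inv_into_right[OF dec_bij[OF assms(1)]] by (simp add: enc_def)
qed

lemma dec_functional:
  assumes "M \<in> Ob" "p \<in> carrier (D M)"
  shows "dec M p \<in> rmod_hom R M (regular_rmod R)"
  using rmod_hom_closed[OF dec_hom[OF assms(1)] assms(2)] by simp

lemma dec_closed:
  "M \<in> Ob \<Longrightarrow> p \<in> carrier (D M) \<Longrightarrow> m \<in> carrier M \<Longrightarrow> dec M p m \<in> carrier R"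
  by (rule functional_closed[OF dec_functional])

text \<open>A functional is determined by its values and \<open>dec M\<close> is injective. This
  turns the later equations between codes into equations in R.\<close>

lemma dec_inject:
  assumes "M \<in> Ob" "p \<in> carrier (D M)" "q \<in> carrier (D M)"
    and "\<And>m. m \<in> carrier M \<Longrightarrow> dec M p m = dec M q m"
  shows "p = q"
proof -
  have "dec M p = dec M q"
    using assms by (intro rmod_hom_eqI) (auto intro: dec_functional)
  then show ?thesis
    using dec_bij[OF assms(1)] assms(2,3) by (auto simp: bij_betw_def inj_on_def)
qed

section \<open>Transposes of linear maps\<close>

lemma pullback_hom:
  assumes M: "M \<in> Ob" and N: "N \<in> Ob" and f: "f \<in> rmod_hom R M N"
  shows "pullback M N f \<in> rmod_hom R (D N) (D M)"
proof -
  have modM: "right_module R M" using M by (rule Ob_module)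
  have modDN: "right_module R (D N)" using N by (rule D_module)
  \<comment> \<open>The transpose before encoding, with genuine functionals as values. It is linear
    because the operations on functionals are pointwise; \<open>pullback\<close> is \<open>h\<close>
    followed by the linear map \<open>enc M\<close>.\<close>
  define h where "h = (\<lambda>p\<in>carrier (D N). compose (carrier M) (dec N p) f)"
  have "h \<in> rmod_hom R (D N) (dual_rmod R star M)"
  proof (rule rmod_homI)
    fix p q assume pq: "p \<in> carrier (D N)" "q \<in> carrier (D N)"
    then show "h (p \<oplus>\<^bsub>D N\<^esub> q) = h p \<oplus>\<^bsub>dual_rmod R star M\<^esub> h q"
      using f rmod_add_closed[OF modDN pq] rmod_hom_add[OF dec_hom[OF N] pq]
      by (auto simp: h_def compose_def rmod_hom_closed intro!: restrict_ext)
  next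
    fix r p assume p: "r \<in> carrier R" "p \<in> carrier (D N)"
    then show "h (r \<odot>\<^bsub>D N\<^esub> p) = r \<odot>\<^bsub>dual_rmod R star M\<^esub> h p"
      using f rmod_act_closed[OF modDN p] rmod_hom_act[OF dec_hom[OF N] p]
      by (auto simp: h_def compose_def rmod_hom_closed intro!: restrict_ext)
  qed (auto simp: h_def intro: rmod_hom_compose modM f dec_functional N)
  then have "compose (carrier (D N)) (enc M) h \<in> rmod_hom R (D N) (D M)"
    by (rule rmod_hom_compose[OF modDN _ enc_hom[OF M]])
  also have "compose (carrier (D N)) (enc M) h = pullback M N f"
    by (auto simp: compose_def pullback_def h_def)
  finally show ?thesis .
qed

text \<open>Decoding cancels the \<open>enc\<close> inside \<open>pullback\<close>. This is the
  compatibility of \<open>dec\<close> with maps required by \<open>is_hom_duality\<close>.\<close>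

lemma dec_pullback:
  assumes "M \<in> Ob" "N \<in> Ob" "f \<in> rmod_hom R M N" "p \<in> carrier (D N)"
  shows "dec M (pullback M N f p) = compose (carrier M) (dec N p) f"
  using assms unfolding pullback_def
  by (auto intro!: dec_enc rmod_hom_compose Ob_module dec_functional)

lemma dec_pullback_apply:
  assumes "M \<in> Ob" "N \<in> Ob" "f \<in> rmod_hom R M N" "p \<in> carrier (D N)" "m \<in> carrier M"
  shows "dec M (pullback M N f p) m = dec N p (f m)"
  using assms by (simp add: dec_pullback compose_eq)

text \<open>The outer \<open>star\<close> compensates for the one in the action on duals: with a the
  value at m, \<open>star (star r \<otimes> a) = star a \<otimes> r\<close>, which is the right
  action on R.\<close>

lemma evaluation_functional:
  assumes M: "M \<in> Ob" and m: "m \<in> carrier M"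
  shows "(\<lambda>p\<in>carrier (D M). star (dec M p m)) \<in> rmod_hom R (D M) (regular_rmod R)"
  using m rmod_hom_add[OF dec_hom[OF M]] rmod_hom_act[OF dec_hom[OF M]]
  by (intro rmod_homI)
    (auto simp: star_closed dec_closed[OF M] rmod_add_closed[OF D_module[OF M]]
      rmod_act_closed[OF D_module[OF M]] star_add star_mult star_star)

lemma dec_evaluation:
  assumes "M \<in> Ob" "m \<in> carrier M" "p \<in> carrier (D M)"
  shows "dec (D M) (evaluation M m) p = star (dec M p m)"
  using assms unfolding evaluation_def
  by (simp add: dec_enc D_Ob evaluation_functional)

text \<open>Linearity in m comes from the same \<open>star\<close>: with a the value at m,
  \<open>star (a \<otimes> r) = star r \<otimes> star a\<close>, which is the action on the dual of
  \<open>D M\<close>. As for \<open>pullback\<close>, the map is first treated before encoding, as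
  \<open>h\<close>.\<close>

lemma evaluation_hom:
  assumes M: "M \<in> Ob"
  shows "evaluation M \<in> rmod_hom R M (D (D M))"
proof -
  have modM: "right_module R M" using M by (rule Ob_module)
  define h where "h = (\<lambda>m\<in>carrier M. \<lambda>p\<in>carrier (D M). star (dec M p m))"
  have "h \<in> rmod_hom R M (dual_rmod R star (D M))"
  proof (rule rmod_homI)
    fix x y assume xy: "x \<in> carrier M" "y \<in> carrier M"
    then show "h (x \<oplus>\<^bsub>M\<^esub> y) = h x \<oplus>\<^bsub>dual_rmod R star (D M)\<^esub> h y"
      using rmod_add_closed[OF modM xy] rmod_hom_add[OF dec_functional[OF M] xy]
      by (auto simp: h_def star_add dec_closed[OF M] intro!: restrict_ext)
  next
    fix r x assume x: "r \<in> carrier R" "x \<in> carrier M"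
    then show "h (r \<odot>\<^bsub>M\<^esub> x) = r \<odot>\<^bsub>dual_rmod R star (D M)\<^esub> h x"
      using rmod_act_closed[OF modM x] rmod_hom_act[OF dec_functional[OF M] x]
      by (auto simp: h_def star_mult dec_closed[OF M] intro!: restrict_ext)
  qed (auto simp: h_def evaluation_functional M)
  then have "compose (carrier M) (enc (D M)) h \<in> rmod_hom R M (D (D M))"
    by (rule rmod_hom_compose[OF modM _ enc_hom[OF D_Ob[OF M]]])
  also have "compose (carrier M) (enc (D M)) h = evaluation M"
    by (auto simp: compose_def evaluation_def h_def)
  finally show ?thesis .
qed

section \<open>Functoriality, naturality and the triangle identity\<close>

lemma is_functor_dual_functor:
  "is_functor (rmod_cat \<V> R) (op_cat (rmod_cat \<V> R)) dual_functor"
  unfolding is_functor_def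
proof (intro conjI ballI is_category_op_cat is_category_rmod_cat)
  fix M assume M: "M \<in> Ob"
  have id: "(\<lambda>x\<in>carrier M. x) \<in> rmod_hom R M M"
    using M by (intro rmod_hom_id Ob_module)
  note hom = pullback_hom[OF M M id]
  have "pullback M M (\<lambda>x\<in>carrier M. x) = (\<lambda>x\<in>carrier (D M). x)"
  proof (rule rmod_hom_eqI[OF hom rmod_hom_id[OF D_module[OF M]]])
    fix p assume p: "p \<in> carrier (D M)"
    \<comment> \<open>After decoding, this says that a functional composed with the identity has the
      same values.\<close>
    have "pullback M M (\<lambda>x\<in>carrier M. x) p = p"
      using M p by (intro dec_inject[OF M])
        (auto simp: dec_pullback_apply id intro: rmod_hom_closed[OF hom])
    then show "pullback M M (\<lambda>x\<in>carrier M. x) p = (\<lambda>x\<in>carrier (D M). x) p"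
      using p by simp
  qed
  then show "amap dual_functor M M (ident (rmod_cat \<V> R) M) =
      ident (op_cat (rmod_cat \<V> R)) (omap dual_functor M)"
    by simp
next
  fix L M N f g
  assume L: "L \<in> Ob" and M: "M \<in> Ob" and N: "N \<in> Ob"
    and "f \<in> arr (rmod_cat \<V> R) L M" "g \<in> arr (rmod_cat \<V> R) M N"
  then have f: "f \<in> rmod_hom R L M" and g: "g \<in> rmod_hom R M N" by simp_all
  have gf: "compose (carrier L) g f \<in> rmod_hom R L N"
    using L f g by (intro rmod_hom_compose Ob_module)
  note pf = pullback_hom[OF L M f] and pg = pullback_hom[OF M N g]
    and pgf = pullback_hom[OF L N gf]
  \<comment> \<open>The composite in the opposite category pulls back along \<open>g\<close> first,
    then along \<open>f\<close>. Decoded at m in L, both sides become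
    \<open>dec N p (g (f m))\<close>.\<close>
  have "pullback L N (compose (carrier L) g f) =
      compose (carrier (D N)) (pullback L M f) (pullback M N g)"
  proof (rule rmod_hom_eqI[OF pgf rmod_hom_compose[OF D_module[OF N] pg pf]])
    fix p assume p: "p \<in> carrier (D N)"
    have "pullback L N (compose (carrier L) g f) p = pullback L M f (pullback M N g p)"
      using L M N p f g gf
      by (intro dec_inject[OF L])
        (auto simp: dec_pullback_apply compose_eq rmod_hom_closed[OF pg] rmod_hom_closed[OF f]
          intro: rmod_hom_closed[OF pgf] rmod_hom_closed[OF pf])
    then show "pullback L N (compose (carrier L) g f) p =
        compose (carrier (D N)) (pullback L M f) (pullback M N g) p"
      using p by (simp add: compose_eq)
  qed
  then show "amap dual_functor L N (cmp (rmod_cat \<V> R) L M N g f) =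
      cmp (op_cat (rmod_cat \<V> R)) (omap dual_functor L) (omap dual_functor M)
        (omap dual_functor N) (amap dual_functor M N g) (amap dual_functor L M f)"
    by simp
qed (auto simp: D_Ob pullback_hom)

text \<open>Decoded at p in \<open>D N\<close>, both sides become
  \<open>star (dec N p (f m))\<close>: on the right the outer pullback moves to p, giving evaluation
  at m of the functional pulled back along \<open>f\<close>.\<close>

lemma evaluation_natural:
  assumes M: "M \<in> Ob" and N: "N \<in> Ob" and f: "f \<in> rmod_hom R M N"
  shows "compose (carrier M) (evaluation N) f =
    compose (carrier M) (pullback (D N) (D M) (pullback M N f)) (evaluation M)"
proof -
  note DM = D_Ob[OF M] and DN = D_Ob[OF N]
  note pf = pullback_hom[OF M N f]
  note ppf = pullback_hom[OF DN DM pf]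
  note eM = evaluation_hom[OF M] and eN = evaluation_hom[OF N]
  show ?thesis
    unfolding compose_def
  proof (rule restrict_ext)
    fix m assume m: "m \<in> carrier M"
    show "evaluation N (f m) = pullback (D N) (D M) (pullback M N f) (evaluation M m)"
      using m M N DM DN f pf
      by (intro dec_inject[OF DN])
        (auto simp: dec_pullback_apply dec_evaluation rmod_hom_closed[OF eM]
          rmod_hom_closed[OF pf] rmod_hom_closed[OF f]
          intro: rmod_hom_closed[OF eN] rmod_hom_closed[OF ppf])
  qed
qed

text \<open>Decoded at m, the left side is the functional coded by \<open>evaluation (D M) p\<close>
  applied to \<open>evaluation M m\<close>. Unfolding both evaluations gives
  \<open>star (star (dec M p m))\<close>, and the involution removes both stars.\<close>

lemma evaluation_triangle:
  assumes M: "M \<in> Ob"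
  shows "compose (carrier (D M)) (pullback M (D (D M)) (evaluation M)) (evaluation (D M)) =
    (\<lambda>p\<in>carrier (D M). p)"
proof -
  note DM = D_Ob[OF M]
  note DDM = D_Ob[OF DM]
  note e = evaluation_hom[OF M] and eD = evaluation_hom[OF DM]
  note pe = pullback_hom[OF M DDM e]
  show ?thesis
    unfolding compose_def
  proof (rule restrict_ext)
    fix p assume p: "p \<in> carrier (D M)"
    show "pullback M (D (D M)) (evaluation M) (evaluation (D M) p) = p"
      using p M DM DDM e
      by (intro dec_inject[OF M])
        (auto simp: dec_pullback_apply dec_evaluation rmod_hom_closed[OF e]
          rmod_hom_closed[OF eD] star_star dec_closed intro: rmod_hom_closed[OF pe])
  qed
qed

lemma lax_O1_volutive_dual_functor: "lax_O1_volutive (rmod_cat \<V> R) dual_functor evaluation"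
  by (rule lax_O1_volutiveI[OF is_functor_dual_functor])
    (simp_all add: evaluation_hom evaluation_natural evaluation_triangle)

lemma is_hom_duality_dual_functor: "is_hom_duality \<V> R star dual_functor evaluation"
  unfolding is_hom_duality_def
  by (intro exI[of _ dec] conjI ballI)
    (simp_all only: dual_functor_simps dec_hom dec_bij dec_pullback dec_evaluation)

end

section \<open>Choice of codes for the duals\<close>

theorem proposition7p2p11:
  fixes R :: "'r ring" and star :: "'r \<Rightarrow> 'r" and \<V> :: "'u set set"
  assumes "star_ring R star"
    and "size_class \<V>"
  shows "\<exists>d \<eta>. lax_O1_volutive (rmod_cat \<V> R) d \<eta> \<and>
           (dual_closed \<V> R \<longrightarrow> is_hom_duality \<V> R star d \<eta>)"
proof (cases "dual_closed \<V> R")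
  case False
  interpret star_ring R star by fact
  show ?thesis
    using ex_lax_O1_volutive_rmod_cat[OF ring_axioms assms(2)] False by blast
next
  case True
  interpret star_ring R star by fact
  obtain g where g: "\<forall>M\<in>obj (rmod_cat \<V> R).
      inj_on (g M) (rmod_hom R M (regular_rmod R)) \<and>
      g M ` rmod_hom R M (regular_rmod R) \<in> \<V>"
    using bchoice[OF True[unfolded dual_closed_def]] ..
  \<comment> \<open>\<open>D M\<close> is the copy of the dual on the image of the chosen injection
    \<open>g M\<close>, small by \<open>dual_closed\<close>; \<open>dec M\<close> inverts that
    injection.\<close>
  define D where "D = (\<lambda>M. transport_rmod (g M) (dual_rmod R star M))"
  define dec where "dec = (\<lambda>M. \<lambda>p\<in>carrier (D M).
    inv_into (carrier (dual_rmod R star M)) (g M) p)"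
  have "coded_duality R star \<V> D dec"
  proof (intro coded_duality.intro coded_duality_axioms.intro star_ring_axioms)
    fix M assume M: "M \<in> obj (rmod_cat \<V> R)"
    have dual: "right_module R (dual_rmod R star M)"
      using M by (simp add: right_module_dual_rmod)
    have inj: "inj_on (g M) (carrier (dual_rmod R star M))"
      using bspec[OF g M] by simp
    show "right_module R (D M)"
      unfolding D_def by (rule right_module_transport_rmod[OF dual inj])
    show "carrier (D M) \<in> \<V>"
      using bspec[OF g M] by (simp add: D_def transport_rmod_def Let_def)
    show "dec M \<in> rmod_hom R (D M) (dual_rmod R star M)"
      unfolding dec_def D_def by (rule transport_rmod_hom[OF dual inj])
    show "bij_betw (dec M) (carrier (D M)) (carrier (dual_rmod R star M))"
      unfolding dec_def D_def by (rule transport_rmod_bij[OF dual inj])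
  qed
  then interpret coded_duality R star \<V> D dec .
  show ?thesis
    using lax_O1_volutive_dual_functor is_hom_duality_dual_functor by blast
qed

end
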